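(* Let $n, r, m$ be positive integers with $r \leq n/2$ and $m \geq 4nr - 4r^2$, and let $\mathcal{A}: \mathbb{R}^{n\times n} \to \mathbb{R}^m$ be a Gaussian operator. Then, with probability $1$, rank minimization recovers all rank-$r$ matrices simultaneously; that is, with probability $1$ (over the draw of $\mathcal{A}$), for every $M \in \mathbb{R}^{n\times n}$ with $\operatorname{rank}(M) = r$, the matrix $M$ is the unique solution of $$\min_{X \in \mathbb{R}^{n\times n}} \operatorname{rank}(X) \quad \text{subject to} \quad \mathcal{A}(X) = \mathcal{A}(M).$$
   Context: The matrix inner product is $\langle A, B\rangle = \operatorname{trace}(A^* B)$. A linear operator $\mathcal{A}: \mathbb{R}^{n\times n} \to \mathbb{R}^m$ is given by matrices $A_1,\dots,A_m \in \mathbb{R}^{n\times n}$ via $(\mathcal{A}(X))_i = \langle A_i, X\rangle$ for $i = 1,\dots,m$. It is called a Gaussian operator if the random matrices $A_1,\dots,A_m$ are independent and each $A_i$ has i.i.d. Gaussian entries (nondegenerate, i.e. with positive variance). *)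

theory Defs
  imports "HOL-Probability.Probability"
begin

text \<open>The index types \<open>'n\<close> and \<open>'m\<close> carry the dimensions: \<open>n = CARD('n)\<close>, \<open>m = CARD('m)\<close>.\<close>

text \<open>\<open>trace(A\<^sup>* B)\<close>; for real matrices the adjoint is the transpose.\<close>

definition mat_inner :: "real^'n^'n \<Rightarrow> real^'n^'n \<Rightarrow> real" where
  "mat_inner A B = trace (transpose A ** B)"

definition meas_op :: "('m::finite \<Rightarrow> real^'n^'n) \<Rightarrow> real^'n^'n \<Rightarrow> real^'m" where
  "meas_op A X = (\<chi> i. mat_inner (A i) X)"

text \<open>
  A Gaussian operator is a random operator on the probability space \<open>M\<close>. The entries of one
  matrix \<open>A i\<close> share a mean and a positive standard deviation, which may differ between
  different \<open>i\<close>; the mean need not be zero.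
\<close>

definition (in prob_space) gaussian_operator ::
    "('a \<Rightarrow> real^'n^'n \<Rightarrow> real^'m::finite) \<Rightarrow> bool" where
  "gaussian_operator \<A> \<longleftrightarrow>
     (\<exists>A :: 'm \<Rightarrow> 'a \<Rightarrow> real^'n^'n.
        (\<forall>\<omega>\<in>space M. \<A> \<omega> = meas_op (\<lambda>i. A i \<omega>)) \<and>
        indep_vars (\<lambda>_. borel) A UNIV \<and>
        (\<forall>i. indep_vars (\<lambda>_. borel) (\<lambda>(j, k) \<omega>. A i \<omega> $ j $ k) (UNIV :: ('n \<times> 'n) set) \<and>
             (\<exists>\<mu> \<sigma>. \<sigma> > 0 \<and>
                (\<forall>j k. distributed M lborel (\<lambda>\<omega>. A i \<omega> $ j $ k) (normal_density \<mu> \<sigma>)))))"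

definition rank_min_solutions ::
    "(real^'n^'n \<Rightarrow> real^'m) \<Rightarrow> real^'m \<Rightarrow> (real^'n^'n) set" where
  "rank_min_solutions \<A> b = {X. is_arg_min rank (\<lambda>X. \<A> X = b) X}"

end

theory Submission
  imports Defs
begin

text \<open>
  If \<open>X \<noteq> M\<close> is feasible and \<open>rank X \<le> rank M = r\<close>, then \<open>X - M\<close> is a nonzero matrix of rank at most
  \<open>s = 2r\<close> in the kernel of the operator, so it suffices that almost surely there is no such matrix.
  A matrix of rank at most \<open>s\<close> is determined by \<open>s\<close> of its rows, indexed by \<open>I\<close>, and the coefficients
  expressing the remaining rows through them; these are \<open>s n + (n - s) s = 4 n r - 4 r\<^sup>2 \<le> m\<close> parameters.
  One nonzero entry \<open>(a, b)\<close> with \<open>a \<in> I\<close> can be scaled to \<open>1\<close>, which uses up one parameter. An operator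
  whose kernel contains the scaled matrix is determined by that matrix and by all entries of
  \<open>A\<^sub>1, \<dots>, A\<^sub>m\<close> other than the \<open>m\<close> entries at \<open>(a, b)\<close>. Storing the parameters in these \<open>m\<close> free slots
  exhibits the bad operators as a finite union of images of hyperplanes under polynomial maps,
  hence as a Lebesgue null set, and the law of the operator is absolutely continuous.
\<close>

section \<open>Linear algebra: the trace inner product, rank and row dependence\<close>

lemma mat_inner_eq_inner: "mat_inner A B = inner A B"
proof -
  have "mat_inner A B = (\<Sum>k\<in>UNIV. \<Sum>j\<in>UNIV. A $ j $ k * B $ j $ k)"
    by (simp add: mat_inner_def trace_def matrix_matrix_mult_def transpose_def)
  also have "\<dots> = inner A B"
    unfolding inner_vec_def by (subst sum.swap) simp
  finally show ?thesis .
qed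

lemma rank_diff_le:
  fixes A B :: "real^'n^'m"
  shows "rank (A - B) \<le> rank A + rank B"
proof -
  let ?R = "range ((*v) A)" and ?S = "range ((*v) B)"
  have sub: "subspace ?R" "subspace ?S"
    by (auto intro!: linear_subspace_image simp: matrix_vector_mul_linear)
  have "range ((*v) (A - B)) \<subseteq> {x + y |x y. x \<in> ?R \<and> y \<in> ?S}"
  proof clarify
    fix x
    have "(A - B) *v x = A *v x + B *v (- x)"
      by (simp add: matrix_vector_mult_diff_rdistrib mult_minus_right vec.neg)
    then show "\<exists>xa y. (A - B) *v x = xa + y \<and> xa \<in> ?R \<and> y \<in> ?S"
      by blast
  qed
  then have "rank (A - B) \<le> dim {x + y |x y. x \<in> ?R \<and> y \<in> ?S}"
    by (simp add: rank_dim_range dim_subset)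
  also have "\<dots> \<le> rank A + rank B"
    using dim_sums_Int[OF sub] by (simp add: rank_dim_range)
  finally show ?thesis .
qed

text \<open>A basis of the row space can be chosen among the rows. Fixing the size of
  \<open>I\<close> to exactly \<open>s\<close>, instead of at most \<open>s\<close>, gives all
  matrices of rank at most \<open>s\<close> the same parameter count.\<close>

lemma rank_le_rows_combination:
  fixes Z :: "real^'n^'m"
  assumes "rank Z \<le> s" and "s \<le> CARD('m)"
  obtains I c where "card I = s" and "\<And>j. Z $ j = (\<Sum>i\<in>I. c j i *\<^sub>R Z $ i)"
proof -
  obtain B where B: "B \<subseteq> rows Z" "independent B" "rows Z \<subseteq> span B" "card B = dim (rows Z)"
    using basis_exists by blast
  have finB: "finite B"
    using B(2) by (rule independent_imp_finite)
  have rowsZ: "rows Z = range (($) Z)"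
    by (auto simp: rows_def row_def vec_lambda_eta)
  with B(1) obtain I0 where I0: "inj_on (($) Z) I0" "B = ($) Z ` I0"
    by (metis subset_image_inj)
  have "card I0 \<le> s"
    using assms(1) B(4) I0 by (simp add: row_rank_def card_image)
  \<comment> \<open>Pad the index set of the basis up to size \<open>s\<close>; the added rows get
    coefficient 0 below.\<close>
  then obtain I where I: "I0 \<subseteq> I" "card I = s"
    using obtain_subset_with_card_n exists_subset_between[of I0 s UNIV] assms(2) by auto
  have "\<exists>c. Z $ j = (\<Sum>i\<in>I. c i *\<^sub>R Z $ i)" for j
  proof -
    have "Z $ j \<in> span B"
      using B(3) rowsZ by blast
    then obtain u where "Z $ j = (\<Sum>v\<in>B. u v *\<^sub>R v)"
      using span_finite[OF finB] by auto
    also have "\<dots> = (\<Sum>i\<in>I0. u (Z $ i) *\<^sub>R Z $ i)"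
      using I0 by (simp add: sum.reindex)
    also have "\<dots> = (\<Sum>i\<in>I. (if i \<in> I0 then u (Z $ i) else 0) *\<^sub>R Z $ i)"
      using I(1) by (intro sum.mono_neutral_cong_left) auto
    finally show ?thesis by (intro exI)
  qed
  then obtain c where "\<And>j. Z $ j = (\<Sum>i\<in>I. c j i *\<^sub>R Z $ i)"
    by metis
  with I(2) that show thesis by blast
qed

section \<open>Operators with a low-rank kernel matrix form a null set\<close>

lemma differentiable_vec_lambda:
  fixes f :: "'i::finite \<Rightarrow> 'a::real_normed_vector \<Rightarrow> 'b::euclidean_space"
  assumes "\<And>i. f i differentiable F"
  shows "(\<lambda>x. \<chi> i. f i x) differentiable F"
proof -
  obtain f' where f': "\<And>i. (f i has_derivative f' i) F"
    using assms unfolding differentiable_def by metis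
  have eq: "(\<chi> i. g i) = (\<Sum>i\<in>UNIV. axis i (g i))" for g :: "'i \<Rightarrow> 'b"
    by (simp add: vec_eq_iff axis_def)
  have ax: "bounded_linear (axis i :: 'b \<Rightarrow> 'b^'i)" for i
    by (intro linear_conv_bounded_linear[THEN iffD1] linearI) (simp_all add: vec_eq_iff axis_def)
  have "((\<lambda>x. \<Sum>i\<in>UNIV. axis i (f i x)) has_derivative (\<lambda>h. \<Sum>i\<in>UNIV. axis i (f' i h))) F"
    by (intro has_derivative_sum bounded_linear.has_derivative[OF ax] f')
  then show ?thesis
    unfolding eq differentiable_def by blast
qed

lemma differentiable_vec_nth:
  fixes f :: "'a::real_normed_vector \<Rightarrow> 'b::real_normed_vector^'i"
  assumes "f differentiable F"
  shows "(\<lambda>x. f x $ i) differentiable F"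
  using assms bounded_linear.has_derivative[OF bounded_linear_vec_nth]
  unfolding differentiable_def by blast

text \<open>
  The map \<open>g\<close> names the coordinate of \<open>u\<close> holding each parameter: for \<open>j \<in> I\<close> the slot \<open>(j, k)\<close> is
  a matrix entry, for \<open>j \<notin> I\<close> the slot \<open>(j, i)\<close> with \<open>i \<in> I\<close> is a coefficient of row \<open>i\<close>.
\<close>

definition row_chart :: "'n set \<Rightarrow> ('n \<times> 'n \<Rightarrow> 'm) \<Rightarrow> real^'m \<Rightarrow> real^'n^'n" where
  "row_chart I g u = (\<chi> j k. if j \<in> I then u $ g (j, k) else (\<Sum>i\<in>I. u $ g (j, i) * u $ g (i, k)))"

text \<open>
  The entries \<open>A $ i $ a $ b\<close> carry the parameters of a matrix \<open>W\<close>. When \<open>W $ a $ b = 1\<close>, they are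
  overwritten so that all \<open>A $ i\<close> become orthogonal to \<open>W\<close>.
\<close>

definition kernel_map ::
    "'n set \<Rightarrow> ('n \<times> 'n \<Rightarrow> 'm) \<Rightarrow> 'n \<Rightarrow> 'n \<Rightarrow> real^'n^'n^'m \<Rightarrow> real^'n^'n^'m" where
  "kernel_map I g a b A =
     (\<chi> i. A $ i - inner (A $ i) (row_chart I g (\<chi> i. A $ i $ a $ b)) *\<^sub>R axis a (axis b 1))"

lemma kernel_map_differentiable: "kernel_map I g a b differentiable (at x within S)"
proof -
  \<comment> \<open>Written out entrywise, the map is polynomial in the entries of
    \<open>A\<close>.\<close>
  have *: "kernel_map I g a b = (\<lambda>A. \<chi> i j k. A $ i $ j $ k -
      (\<Sum>j\<in>UNIV. \<Sum>k\<in>UNIV. A $ i $ j $ k *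
         (if j \<in> I then A $ g (j, k) $ a $ b else (\<Sum>i\<in>I. A $ g (j, i) $ a $ b * A $ g (i, k) $ a $ b))) *
      (axis a (axis b 1) $ j $ k))"
    by (intro ext) (simp add: kernel_map_def row_chart_def vec_eq_iff inner_vec_def cong: if_cong)
  have if_diff: "(\<lambda>A. if c then f A else h A) differentiable (at x within S)"
    if "f differentiable (at x within S)" "h differentiable (at x within S)" for c and f h :: "real^'a^'a^'b \<Rightarrow> real"
    using that by (cases c) simp_all
  show ?thesis
    unfolding *
    by (intro differentiable_vec_lambda differentiable_diff differentiable_mult differentiable_sum
        ballI finite if_diff differentiable_vec_nth differentiable_ident differentiable_const)
qed

lemma negligible_kernel_meets_low_rank:
  assumes s: "s \<le> CARD('n)" and m: "s * CARD('n) + (CARD('n) - s) * s \<le> CARD('m)"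
  shows "negligible {A :: real^'n^'n^'m. \<exists>Z. Z \<noteq> 0 \<and> rank Z \<le> s \<and> (\<forall>i. inner (A $ i) Z = 0)}"
    (is "negligible ?N")
proof -
  \<comment> \<open>For \<open>a\<close> in \<open>I\<close>, slot \<open>g (a, b)\<close> stores
    the matrix entry at \<open>(a, b)\<close>, so this hyperplane expresses the normalization of
    that entry to 1.\<close>
  let ?H = "\<lambda>g a b. {A :: real^'n^'n^'m. A $ g (a, b) $ a $ b = 1}"
  have negl_H: "negligible (?H g a b)" for g a b
  proof -
    have "?H g a b = {A. inner (axis (g (a, b)) (axis a (axis b 1))) A = 1}"
      by (simp add: inner_axis')
    moreover have "axis (g (a, b)) (axis a (axis b 1)) \<noteq> (0 :: real^'n^'n^'m)"
      by (simp add: axis_eq_0_iff)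
    ultimately show ?thesis
      by (metis negligible_hyperplane)
  qed
  let ?G = "\<lambda>(I, g, a, b). kernel_map I g a b ` ?H g a b"
  have fin: "finite (UNIV :: ('n set \<times> ('n \<times> 'n \<Rightarrow> 'm) \<times> 'n \<times> 'n) set)"
    by simp
  \<comment> \<open>The map goes from the operator space to itself, so differentiability suffices to
    preserve null sets.\<close>
  have negl_image: "negligible (kernel_map I g a b ` ?H g a b)" for I :: "'n set" and g a b
    using negl_H kernel_map_differentiable
    by (intro negligible_differentiable_image_negligible) (auto simp: differentiable_on_def)
  have "negligible (\<Union>(range ?G))"
    using negl_image by (intro negligible_Union) (auto intro: finite_imageI[OF fin])
  moreover have "?N \<subseteq> \<Union>(range ?G)"
  proof clarify
    fix A :: "real^'n^'n^'m" and Z :: "real^'n^'n"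
    assume Z: "Z \<noteq> 0" "rank Z \<le> s" and AZ: "\<forall>i. inner (A $ i) Z = 0"
    obtain I c where I: "card I = s" and c: "\<And>j. Z $ j = (\<Sum>i\<in>I. c j i *\<^sub>R Z $ i)"
      using rank_le_rows_combination[OF Z(2) s] by blast
    \<comment> \<open>Every row is a combination of the rows in \<open>I\<close>, so these cannot
      all vanish.\<close>
    obtain a where a: "a \<in> I" "Z $ a \<noteq> 0"
    proof (rule ccontr)
      assume "\<not> thesis"
      with that have "\<forall>i\<in>I. Z $ i = 0" by blast
      with c have "Z $ j = 0" for j by (metis (no_types, lifting) scaleR_zero_right sum.neutral)
      with Z(1) show False by (simp add: vec_eq_iff)
    qed
    from a(2) obtain b where b: "Z $ a $ b \<noteq> 0"
      by (metis vec_eq_iff zero_index)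
    define W where "W = (1 / Z $ a $ b) *\<^sub>R Z"
    have Wab: "W $ a $ b = 1"
      using b by (simp add: W_def)
    have AW: "inner (A $ i) W = 0" for i
      using AZ by (simp add: W_def)
    have Wc: "W $ j = (\<Sum>i\<in>I. c j i *\<^sub>R W $ i)" for j
      unfolding W_def by (subst vector_scaleR_component, subst c) (simp add: scaleR_sum_right mult.commute)
    \<comment> \<open>\<open>Q\<close> consists of the slots that \<open>row_chart\<close> reads;
      its size is the number of parameters, so \<open>g\<close> can be injective on it.\<close>
    define Q where "Q = I \<times> UNIV \<union> (- I) \<times> I"
    have "card Q = s * CARD('n) + (CARD('n) - s) * s"
      unfolding Q_def using I
      by (subst card_Un_disjoint) (auto simp: card_cartesian_product Compl_eq_Diff_UNIV card_Diff_subset)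
    with m obtain g :: "'n \<times> 'n \<Rightarrow> 'm" where g: "inj_on g Q"
      by (metis card_le_inj finite)
    define v where "v = (\<lambda>(j, k). if j \<in> I then W $ j $ k else c j k)"
    define u where "u = (\<chi> q. v (inv_into Q g q))"
    have u: "u $ g q = v q" if "q \<in> Q" for q
      using that g by (simp add: u_def)
    have chart: "row_chart I g u = W"
    proof -
      have "row_chart I g u $ j $ k = W $ j $ k" for j k
      proof (cases "j \<in> I")
        case True
        then show ?thesis by (simp add: row_chart_def u Q_def v_def)
      next
        case False
        then have "row_chart I g u $ j $ k = (\<Sum>i\<in>I. c j i * W $ i $ k)"
          by (simp add: row_chart_def u Q_def v_def cong: sum.cong)
        also have "\<dots> = W $ j $ k"
          by (subst (2) Wc) simp
        finally show ?thesis .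
      qed
      then show ?thesis by (simp add: vec_eq_iff)
    qed
    define E :: "real^'n^'n" where "E = axis a (axis b 1)"
    \<comment> \<open>The preimage of \<open>A\<close>: overwrite the \<open>(a, b)\<close> entries
      by the parameters. Since \<open>A $ i\<close> is orthogonal to \<open>W\<close> and
      \<open>inner E W = 1\<close>, the inner product of \<open>A' $ i\<close> with \<open>W\<close>
      is exactly the change made, and \<open>kernel_map\<close> undoes it.\<close>
    define A' where "A' = (\<chi> i. A $ i + (u $ i - A $ i $ a $ b) *\<^sub>R E)"
    have A'ab: "A' $ i $ a $ b = u $ i" for i
      by (simp add: A'_def E_def)
    have "A' $ g (a, b) $ a $ b = 1"
      using a(1) Wab by (simp add: A'ab u Q_def v_def)
    moreover have "kernel_map I g a b A' = A"
    proof -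
      have EW: "inner E W = 1"
        by (simp add: E_def inner_axis' Wab)
      have "(\<chi> i. A' $ i $ a $ b) = u"
        by (simp add: A'ab vec_eq_iff)
      then have "kernel_map I g a b A' = (\<chi> i. A' $ i - inner (A' $ i) W *\<^sub>R E)"
        by (simp add: kernel_map_def chart E_def)
      also have "\<dots> = A"
        by (simp add: A'_def vec_eq_iff inner_add_left AW EW)
      finally show ?thesis .
    qed
    ultimately have "A \<in> ?G (I, g, a, b)"
      by force
    then show "A \<in> \<Union>(range ?G)"
      by blast
  qed
  ultimately show ?thesis
    by (rule negligible_subset)
qed

section \<open>Joint independence of the entries\<close>

text \<open>For fixed \<open>i\<close>, the conditions on all components together form one event
  about \<open>A i\<close>. Its probability factors first over \<open>i\<close>, then over
  \<open>j\<close>. This merges independence between the matrices with independence within each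
  matrix.\<close>

lemma (in prob_space) indep_vars_components:
  fixes A :: "'i::finite \<Rightarrow> 'a \<Rightarrow> 'b" and Y :: "'j::finite \<Rightarrow> 'b \<Rightarrow> 'c"
  assumes A: "indep_vars (\<lambda>_. N) A UNIV"
    and Y: "\<And>j. Y j \<in> measurable N L"
    and YA: "\<And>i. indep_vars (\<lambda>_. L) (\<lambda>j \<omega>. Y j (A i \<omega>)) UNIV"
  shows "indep_vars (\<lambda>_. L) (\<lambda>(i, j) \<omega>. Y j (A i \<omega>)) UNIV"
proof -
  have A_rv [measurable]: "random_variable N (A i)" for i
    using A by (auto simp: indep_vars_def)
  note Y [measurable]
  have "prob (\<Inter>p\<in>UNIV. (\<lambda>(i, j) \<omega>. Y j (A i \<omega>)) p -` E p \<inter> space M) =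
      (\<Prod>p\<in>UNIV. prob ((\<lambda>(i, j) \<omega>. Y j (A i \<omega>)) p -` E p \<inter> space M))"
    if E: "E \<in> (\<Pi> p\<in>UNIV. sets L)" for E
  proof -
    have E' [measurable]: "E p \<in> sets L" for p
      using E by auto
    let ?B = "\<lambda>i. (\<Inter>j\<in>UNIV. Y j -` E (i, j) \<inter> space N)"
    have B: "?B i \<in> sets N" for i
      by (intro sets.finite_INT) auto
    have pre: "(\<Inter>j\<in>UNIV. (\<lambda>\<omega>. Y j (A i \<omega>)) -` E (i, j) \<inter> space M) = A i -` ?B i \<inter> space M" for i
      using measurable_space[OF A_rv] by auto
    have "(\<Inter>p\<in>UNIV. (\<lambda>(i, j) \<omega>. Y j (A i \<omega>)) p -` E p \<inter> space M) =
        (\<Inter>i\<in>UNIV. A i -` ?B i \<inter> space M)"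
      using measurable_space[OF A_rv] by auto
    then have "prob (\<Inter>p\<in>UNIV. (\<lambda>(i, j) \<omega>. Y j (A i \<omega>)) p -` E p \<inter> space M) =
        (\<Prod>i\<in>UNIV. prob (A i -` ?B i \<inter> space M))"
      using indep_varsD_finite[OF A, of ?B] B by simp
    also have "\<dots> = (\<Prod>i\<in>UNIV. \<Prod>j\<in>UNIV. prob ((\<lambda>\<omega>. Y j (A i \<omega>)) -` E (i, j) \<inter> space M))"
      unfolding pre[symmetric]
      using indep_varsD_finite[OF YA, of "\<lambda>j. E (i, j)" for i] by (intro prod.cong) auto
    also have "\<dots> = (\<Prod>p\<in>UNIV. prob ((\<lambda>(i, j) \<omega>. Y j (A i \<omega>)) p -` E p \<inter> space M))"
      by (simp add: prod.cartesian_product split_def UNIV_Times_UNIV[symmetric] del: UNIV_Times_UNIV)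
    finally show ?thesis .
  qed
  moreover have "random_variable L ((\<lambda>(i, j) \<omega>. Y j (A i \<omega>)) p)" for p
    by (cases p) simp
  \<comment> \<open>Each full sigma-algebra serves as its own intersection-stable generator; as it
    contains the whole space, the product formula over all indices suffices.\<close>
  ultimately show ?thesis
    using indep_vars_finite[of UNIV "\<lambda>_. L" "\<lambda>_. sets L" "\<lambda>(i, j) \<omega>. Y j (A i \<omega>)"]
      sets.sigma_sets_eq[of L] sets.Int_stable[of L] sets.space_closed[of L]
    by simp
qed

section \<open>Absolute continuity of the law of the operator\<close>

text \<open>Measurable boxes determine a product measure, and on a box both the density and the
  indicator factor over the coordinates. Sigma-finiteness of the reweighted factors is assumed
  because a density can destroy it.\<close>

lemma (in product_sigma_finite) density_PiM:
  assumes I: "finite I" and f [measurable]: "\<And>i. i \<in> I \<Longrightarrow> f i \<in> borel_measurable (M i)"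
    and sf: "product_sigma_finite (\<lambda>i. density (M i) (f i))"
  shows "PiM I (\<lambda>i. density (M i) (f i)) = density (PiM I M) (\<lambda>x. \<Prod>i\<in>I. f i (x i))"
proof (rule product_sigma_finite.PiM_eqI[OF sf I, symmetric])
  show "sets (density (PiM I M) (\<lambda>x. \<Prod>i\<in>I. f i (x i))) = sets (PiM I (\<lambda>i. density (M i) (f i)))"
    by (simp cong: sets_PiM_cong)
next
  fix A assume A: "\<And>i. i \<in> I \<Longrightarrow> A i \<in> sets (density (M i) (f i))"
  then have A' [measurable]: "i \<in> I \<Longrightarrow> A i \<in> sets (M i)" for i
    by simp
  have "emeasure (density (PiM I M) (\<lambda>x. \<Prod>i\<in>I. f i (x i))) (Pi\<^sub>E I A) =
      (\<integral>\<^sup>+x. (\<Prod>i\<in>I. f i (x i)) * indicator (Pi\<^sub>E I A) x \<partial>PiM I M)"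
    using I by (intro emeasure_density borel_measurable_prod_ennreal sets_PiM_I_finite)
      (auto intro: measurable_compose[OF measurable_component_singleton])
  also have "\<dots> = (\<integral>\<^sup>+x. (\<Prod>i\<in>I. f i (x i) * indicator (A i) (x i)) \<partial>PiM I M)"
  proof (rule nn_integral_cong)
    fix x assume "x \<in> space (PiM I M)"
    then have x: "x \<in> extensional I"
      by (simp add: space_PiM PiE_def)
    have "indicator (Pi\<^sub>E I A) x = (\<Prod>i\<in>I. indicator (A i) (x i) :: ennreal)"
    proof (cases "\<forall>i\<in>I. x i \<in> A i")
      case True
      with x show ?thesis by (simp add: PiE_def Pi_def)
    next
      case False
      then obtain i where "i \<in> I" "x i \<notin> A i" by blast
      with I have "(\<Prod>i\<in>I. indicator (A i) (x i) :: ennreal) = 0"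
        by (intro prod_zero bexI[of _ i]) auto
      with False show ?thesis by (auto simp: indicator_def)
    qed
    then show "(\<Prod>i\<in>I. f i (x i)) * indicator (Pi\<^sub>E I A) x = (\<Prod>i\<in>I. f i (x i) * indicator (A i) (x i))"
      by (simp add: prod.distrib)
  qed
  also have "\<dots> = (\<Prod>i\<in>I. \<integral>\<^sup>+x. f i x * indicator (A i) x \<partial>M i)"
    using I by (intro product_nn_integral_prod) auto
  also have "\<dots> = (\<Prod>i\<in>I. emeasure (density (M i) (f i)) (A i))"
    by (intro prod.cong refl emeasure_density[symmetric]) auto
  finally show "emeasure (density (PiM I M) (\<lambda>x. \<Prod>i\<in>I. f i (x i))) (Pi\<^sub>E I A) =
      (\<Prod>i\<in>I. emeasure (density (M i) (f i)) (A i))" .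
qed

text \<open>Carries the product measure on functions of index triples over to Lebesgue measure on
  nested vectors.\<close>

definition array :: "('a \<times> 'b \<times> 'c \<Rightarrow> real) \<Rightarrow> real^'c^'b^'a" where
  "array f = (\<chi> i j k. f (i, j, k))"

lemma array_nth [simp]: "array f $ i $ j $ k = f (i, j, k)"
  by (simp add: array_def)

definition array_axis :: "'a \<times> 'b \<times> 'c \<Rightarrow> real^'c^'b^'a" where
  "array_axis = (\<lambda>(i, j, k). axis i (axis j (axis k 1)))"

lemma Basis_array: "Basis = (range array_axis :: (real^'c^'b^'a) set)"
proof (intro equalityI subsetI)
  fix b :: "real^'c^'b^'a"
  assume "b \<in> Basis"
  then obtain i j k where "b = array_axis (i, j, k)"
    by (auto simp: Basis_vec_def array_axis_def)
  then show "b \<in> range array_axis" by simp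
qed (auto simp: array_axis_def)

lemma inj_array_axis: "inj array_axis"
  by (auto simp: inj_on_def array_axis_def axis_eq_axis)

lemma inner_array_axis: "inner x (array_axis (i, j, k)) = x $ i $ j $ k"
  by (simp add: array_axis_def inner_axis)

lemma measurable_array: "array \<in> borel_measurable (PiM UNIV (\<lambda>_. lborel))"
proof -
  have "(\<lambda>f. f p) \<in> borel_measurable (PiM UNIV (\<lambda>_. lborel :: real measure))" for p :: "'a \<times> 'b \<times> 'c"
    using measurable_component_singleton[of p UNIV "\<lambda>_. lborel :: real measure"] by simp
  then show ?thesis
    by (subst borel_measurable_euclidean_space) (auto simp: Basis_array inner_array_axis)
qed

text \<open>Lebesgue measure is determined by its values on open boxes, and the preimage of a box
  under \<open>array\<close> is a product of intervals.\<close>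

lemma lborel_eq_distr_array:
  "lborel = distr (PiM UNIV (\<lambda>_. lborel)) borel (array :: _ \<Rightarrow> real^'c^'b^'a)"
proof (rule lborel_eqI)
  interpret product_sigma_finite "\<lambda>_ :: 'a \<times> 'b \<times> 'c. lborel :: real measure" ..
  fix l u :: "real^'c^'b^'a"
  assume le: "\<And>b. b \<in> Basis \<Longrightarrow> l \<bullet> b \<le> u \<bullet> b"
  let ?I = "\<lambda>p. {l \<bullet> array_axis p <..< u \<bullet> array_axis p}"
  have "array -` box l u \<inter> space (PiM UNIV (\<lambda>_. lborel)) = Pi\<^sub>E UNIV ?I"
    by (auto simp: space_PiM box_def Basis_array inner_array_axis PiE_def Pi_def)
  then have "emeasure (distr (PiM UNIV (\<lambda>_. lborel)) borel array) (box l u) =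
      emeasure (PiM UNIV (\<lambda>_. lborel)) (Pi\<^sub>E UNIV ?I)"
    by (simp add: emeasure_distr measurable_array)
  also have "\<dots> = (\<Prod>p\<in>UNIV. emeasure lborel (?I p))"
    by (rule emeasure_PiM) auto
  also have "\<dots> = (\<Prod>p\<in>UNIV. ennreal ((u - l) \<bullet> array_axis p))"
    using le by (intro prod.cong refl) (auto simp: Basis_array inner_diff_left)
  also have "\<dots> = ennreal (\<Prod>p\<in>UNIV. (u - l) \<bullet> array_axis p)"
    using le by (intro prod_ennreal) (auto simp: Basis_array inner_diff_left)
  also have "\<dots> = ennreal (\<Prod>b\<in>Basis. (u - l) \<bullet> b)"
    by (simp add: Basis_array prod.reindex[OF inj_array_axis])
  finally show "emeasure (distr (PiM UNIV (\<lambda>_. lborel)) borel array) (box l u) = (\<Prod>b\<in>Basis. (u - l) \<bullet> b)" .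
qed simp

lemma (in prob_space) AE_array_not_in_negligible:
  fixes X :: "'i::finite \<times> 'j::finite \<times> 'k::finite \<Rightarrow> 'a \<Rightarrow> real"
  assumes X: "indep_vars (\<lambda>_. borel) X UNIV"
    and f: "\<And>p. distributed M lborel (X p) (f p)"
    and N: "negligible N"
  shows "AE \<omega> in M. array (\<lambda>p. X p \<omega>) \<notin> N"
proof -
  have X_rv [measurable]: "random_variable borel (X p)" for p
    using X unfolding indep_vars_def by blast
  have f_meas [measurable]: "f p \<in> borel_measurable borel" for p
    using distributed_borel_measurable[OF f[of p]] by simp
  have distr_X: "distr M borel (X p) = density lborel (f p)" for p
    using distributed_distr_eq_density[OF f[of p]] by (simp cong: distr_cong)
  interpret lb: product_sigma_finite "\<lambda>_ :: 'i \<times> 'j \<times> 'k. lborel :: real measure" ..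
  have "prob_space (density lborel (f p))" for p
    using prob_space_distr[OF X_rv, of p] by (simp add: distr_X)
  then have sf: "product_sigma_finite (\<lambda>p. density lborel (f p))"
    unfolding product_sigma_finite_def using prob_space_imp_sigma_finite by blast
  \<comment> \<open>By independence the joint law is the product of the marginals, hence has a
    density with respect to product Lebesgue measure.\<close>
  have law: "distr M (PiM UNIV (\<lambda>_. borel)) (\<lambda>\<omega> p. X p \<omega>) =
      density (PiM UNIV (\<lambda>_. lborel)) (\<lambda>x. \<Prod>p\<in>UNIV. f p (x p))"
    using X indep_vars_iff_distr_eq_PiM[of UNIV X "\<lambda>_. borel"] lb.density_PiM[OF _ _ sf]
    by (simp add: distr_X restrict_UNIV)
  \<comment> \<open>A negligible set may fail to be Borel, so it is enclosed in a Borel null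
    set.\<close>
  obtain N' where N': "N' \<in> null_sets lborel" "N \<subseteq> N'"
    using N by (auto simp: negligible_iff_null_sets null_sets_completion_iff2)
  have "AE x in distr (PiM UNIV (\<lambda>_. lborel)) borel array. x \<notin> N'"
    by (subst lborel_eq_distr_array[symmetric]) (rule AE_not_in[OF N'(1)])
  then have AE_lborel: "AE x in PiM UNIV (\<lambda>_. lborel). array x \<notin> N'"
    by (rule AE_distrD[OF measurable_array])
  have "(\<lambda>x. f p (x p)) \<in> borel_measurable (PiM UNIV (\<lambda>_. lborel))" for p
    by (rule measurable_compose[OF measurable_component_singleton[OF UNIV_I]]) simp
  then have "(\<lambda>x. \<Prod>p\<in>UNIV. f p (x p)) \<in> borel_measurable (PiM UNIV (\<lambda>_. lborel))"
    by (rule borel_measurable_prod_ennreal)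
  then have "AE x in distr M (PiM UNIV (\<lambda>_. borel)) (\<lambda>\<omega> p. X p \<omega>). array x \<notin> N'"
    unfolding law using AE_lborel by (subst AE_density) (auto elim: AE_mp)
  moreover have "(\<lambda>\<omega> p. X p \<omega>) \<in> measurable M (PiM UNIV (\<lambda>_. borel))"
    by (rule measurable_PiM_single') (use X_rv in \<open>auto simp: PiE_def\<close>)
  ultimately have "AE \<omega> in M. array (\<lambda>p. X p \<omega>) \<notin> N'"
    by (rule AE_distrD[rotated])
  with N'(2) show ?thesis
    by auto
qed

section \<open>From the kernel condition to unique recovery\<close>

lemma rank_min_solutions_eq_singleton:
  fixes A :: "'m::finite \<Rightarrow> real^'n^'n" and M :: "real^'n^'n"
  assumes ker: "\<And>Z. Z \<noteq> 0 \<Longrightarrow> rank Z \<le> 2 * rank M \<Longrightarrow> \<exists>i. inner (A i) Z \<noteq> 0"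
  shows "rank_min_solutions (meas_op A) (meas_op A M) = {M}"
proof -
  have uniq: "X = M" if "meas_op A X = meas_op A M" "rank X \<le> rank M" for X
  proof (rule ccontr)
    assume "X \<noteq> M"
    moreover have "rank (X - M) \<le> 2 * rank M"
      using rank_diff_le[of X M] that(2) by simp
    moreover have "inner (A i) (X - M) = 0" for i
      using that(1) by (simp add: meas_op_def vec_eq_iff mat_inner_eq_inner inner_diff_right)
    ultimately show False
      using ker[of "X - M"] by simp
  qed
  \<comment> \<open>\<open>uniq\<close> is used twice: a feasible matrix of smaller rank would equal
    \<open>M\<close>, so \<open>M\<close> is a minimizer; any other minimizer has rank at most that
    of the feasible \<open>M\<close>.\<close>
  then have "is_arg_min rank (\<lambda>X. meas_op A X = meas_op A M) M"
    unfolding is_arg_min_def by (metis less_imp_le less_irrefl)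
  moreover have "X = M" if "is_arg_min rank (\<lambda>X. meas_op A X = meas_op A M) X" for X
    using that uniq unfolding is_arg_min_def by (metis not_less)
  ultimately show ?thesis
    unfolding rank_min_solutions_def by blast
qed

theorem theorem2p1:
  fixes P :: "'w measure"
    and \<A> :: "'w \<Rightarrow> real^'n^'n \<Rightarrow> real^'m"
    and r :: nat
  assumes "prob_space P"
    and "r > 0"
    and "real r \<le> real CARD('n) / 2"
    and "real CARD('m) \<ge> 4 * real CARD('n) * real r - 4 * (real r)\<^sup>2"
    and "prob_space.gaussian_operator P \<A>"
  shows "AE \<omega> in P. \<forall>M :: real^'n^'n. rank M = r \<longrightarrow>
           rank_min_solutions (\<A> \<omega>) (\<A> \<omega> M) = {M}"
proof -
  interpret prob_space P by fact
  obtain A :: "'m \<Rightarrow> 'w \<Rightarrow> real^'n^'n" where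
    op: "\<And>\<omega>. \<omega> \<in> space P \<Longrightarrow> \<A> \<omega> = meas_op (\<lambda>i. A i \<omega>)" and
    indep_A: "indep_vars (\<lambda>_. borel) A UNIV" and
    indep_entries: "\<And>i. indep_vars (\<lambda>_. borel) (\<lambda>(j, k) \<omega>. A i \<omega> $ j $ k) (UNIV :: ('n \<times> 'n) set)" and
    "\<And>i. \<exists>\<mu> \<sigma>. \<sigma> > 0 \<and> (\<forall>j k. distributed P lborel (\<lambda>\<omega>. A i \<omega> $ j $ k) (normal_density \<mu> \<sigma>))"
    using assms(5) unfolding gaussian_operator_def by blast
  then obtain \<mu> \<sigma> where
    density: "\<And>i j k. distributed P lborel (\<lambda>\<omega>. A i \<omega> $ j $ k) (normal_density (\<mu> i) (\<sigma> i))"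
    by metis
  define N where "N = {B :: real^'n^'n^'m. \<exists>Z. Z \<noteq> 0 \<and> rank Z \<le> 2 * r \<and> (\<forall>i. inner (B $ i) Z = 0)}"
  have r_le: "2 * r \<le> CARD('n)"
    using assms(3) by linarith
  \<comment> \<open>With \<open>s = 2 * r\<close> the parameter count is 4nr - 4r^2;
    \<open>r_le\<close> makes the natural-number subtraction exact.\<close>
  then have "real (2 * r * CARD('n) + (CARD('n) - 2 * r) * (2 * r)) \<le> real CARD('m)"
    using assms(4) by (simp add: of_nat_diff algebra_simps power2_eq_square)
  with r_le have "negligible N"
    unfolding N_def by (intro negligible_kernel_meets_low_rank) linarith+
  moreover have "indep_vars (\<lambda>_. borel) (\<lambda>(i, j, k) \<omega>. A i \<omega> $ j $ k) (UNIV :: ('m \<times> 'n \<times> 'n) set)"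
    using indep_vars_components[OF indep_A, of "\<lambda>(j, k) B. B $ j $ k" borel] indep_entries
    by (simp add: split_def borel_measurable_continuous_onI continuous_intros)
  ultimately have "AE \<omega> in P. array (\<lambda>p. (\<lambda>(i, j, k) \<omega>. A i \<omega> $ j $ k) p \<omega>) \<notin> N"
    using density
    by (intro AE_array_not_in_negligible[where f = "\<lambda>(i, j, k). normal_density (\<mu> i) (\<sigma> i)"]) auto
  moreover have "array (\<lambda>p. (\<lambda>(i, j, k) \<omega>. A i \<omega> $ j $ k) p \<omega>) = (\<chi> i. A i \<omega>)" for \<omega>
    by (simp add: vec_eq_iff)
  ultimately have "AE \<omega> in P. (\<chi> i. A i \<omega>) \<notin> N"
    by simp
  then show ?thesis
  proof (rule AE_mp, intro AE_I2 impI allI)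
    fix \<omega> and M :: "real^'n^'n"
    assume "\<omega> \<in> space P" "(\<chi> i. A i \<omega>) \<notin> N" "rank M = r"
    then show "rank_min_solutions (\<A> \<omega>) (\<A> \<omega> M) = {M}"
      using op by (auto simp: N_def intro!: rank_min_solutions_eq_singleton)
  qed
qed

end
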